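(* Let $\psi:\mathbb{R}\to\mathbb{R}$ be an even continuous strictly positive function that is monotone increasing for $x\ge0$ and such that $V_0=\int_{-\infty}^\infty e^{-\psi^2(t)}dt<\infty$. Let $\delta>0$, $0<\sigma<1$, and let $c=c(N)=N^{1-\sigma}$ and $R=R(N)=\delta N^{\sigma}$, so that $cR/N=\delta$, where $N=2n+1$ ranges over odd positive integers. Assume that the infinite family $\{\mathcal{A}_{N,c,R}\}_N$ of families of random variables $\mathcal{A}_{N,c,R}=\{a_{ij}^{(N,c,R)},\,-n\le i<j\le n\}$ described in the context is determined on the same probability space. Then $$P\left(\lim_{N\to\infty}\Delta_{N,c,R}=\frac{\delta V_0}{2}\right)=1\qquad\text{and}\qquad P\left(\liminf_{N\to\infty}T_{N,c,R}=+\infty\right)=1.$$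
   Context: For $N=2n+1$, $L_N=\{-n,\dots,n\}$, the random variables $a_{ij}^{(N,c,R)}$, $-n\le i<j\le n$, are (for each $N$) jointly independent with values in $\{0,1\}$ and $P(a_{ij}^{(N,c,R)}=1)=\frac{c}{N}e^{-\psi^2((i-j)/R)}$ (for $N$ large enough that $c\le N$). Put $a_{ji}=a_{ij}$ and $a_{ii}=0$, and let $A_{N,c,R}=(a_{ij}^{(N,c,R)})_{i,j\in L_N}$, the adjacency matrix of a random graph. Define the average vertex degree variable $\Delta_{N,c,R}=\frac1{2N}\sum_{i,j\in L_N}a_{ij}^{(N,c,R)}$ and the number of triangles $T_{N,c,R}=\frac16\mathrm{Tr}\,(A_{N,c,R})^3$. *)

theory Defs
  imports "HOL-Probability.Probability" "Jordan_Normal_Form.Matrix"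
begin

definition graph_size :: "nat \<Rightarrow> nat" where
  "graph_size n = 2 * n + 1"

definition vertices :: "nat \<Rightarrow> int set" where
  "vertices n = {- int n..int n}"

definition edge_pairs :: "nat \<Rightarrow> (int \<times> int) set" where
  "edge_pairs n = {(i, j). i \<in> vertices n \<and> j \<in> vertices n \<and> i < j}"

(* Independence concerns one fixed n; nothing is said about the joint law for different n. *)
definition edge_variables ::
  "'w measure \<Rightarrow> (real \<Rightarrow> real) \<Rightarrow> real \<Rightarrow> real \<Rightarrow> nat \<Rightarrow> (int \<times> int \<Rightarrow> 'w \<Rightarrow> real) \<Rightarrow> bool"
where
  "edge_variables M \<psi> c R n a \<longleftrightarrow>
     prob_space.indep_vars M (\<lambda>_. borel) a (edge_pairs n) \<and>
     (\<forall>(i, j) \<in> edge_pairs n.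
        (\<forall>\<omega> \<in> space M. a (i, j) \<omega> \<in> {0, 1}) \<and>
        \<P>(\<omega> in M. a (i, j) \<omega> = 1) =
          c / real (graph_size n) * exp (- (\<psi> (real_of_int (i - j) / R))\<^sup>2))"

definition adj_entry :: "(int \<times> int \<Rightarrow> 'w \<Rightarrow> real) \<Rightarrow> 'w \<Rightarrow> int \<Rightarrow> int \<Rightarrow> real" where
  "adj_entry a \<omega> i j =
     (if i < j then a (i, j) \<omega> else if j < i then a (j, i) \<omega> else 0)"

(* Matrix indices run over 0, ..., 2 n; index k stands for the vertex k - n. *)
definition adj_matrix :: "nat \<Rightarrow> (int \<times> int \<Rightarrow> 'w \<Rightarrow> real) \<Rightarrow> 'w \<Rightarrow> real mat" where
  "adj_matrix n a \<omega> =
     mat (graph_size n) (graph_size n)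
       (\<lambda>(k, l). adj_entry a \<omega> (int k - int n) (int l - int n))"

definition mat_trace :: "'a :: comm_monoid_add mat \<Rightarrow> 'a" where
  "mat_trace A = (\<Sum>k<dim_row A. A $$ (k, k))"

definition avg_degree :: "nat \<Rightarrow> (int \<times> int \<Rightarrow> 'w \<Rightarrow> real) \<Rightarrow> 'w \<Rightarrow> real" where
  "avg_degree n a \<omega> =
     1 / (2 * real (graph_size n)) * (\<Sum>i\<in>vertices n. \<Sum>j\<in>vertices n. adj_entry a \<omega> i j)"

definition triangles :: "nat \<Rightarrow> (int \<times> int \<Rightarrow> 'w \<Rightarrow> real) \<Rightarrow> 'w \<Rightarrow> real" where
  "triangles n a \<omega> = 1 / 6 * mat_trace (adj_matrix n a \<omega> ^\<^sub>m 3)"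

end

(*
  Write N = 2n+1. Each edge has probability of order at most N^(-sigma), and only the N * R pairs
  at distance O(R), R = delta * N^sigma, matter; so the number of edges has mean of order N.

  Average degree: the mean is a tapered Riemann sum for delta * integral of exp(-psi^2) over (0, inf).
  It converges by dominated convergence, since the step functions are dominated by exp(-psi^2). A
  Chernoff bound for the number of edges makes deviations exponentially unlikely in N, so
  Borel-Cantelli applies although nothing is known about the joint law for different N.

  Triangles: the variance of their number is too large for Chebyshev and Borel-Cantelli. Instead cut
  the vertices into about N / (3R) = N^(1-sigma) / (3 delta) consecutive blocks of about 3R vertices and
  count in every block only the triangles with one vertex in each third. The block counts Y are
  independent with E Y >= m1 > 0 and E Y^2 <= m2, uniformly in N, so that
  E exp(-sY) <= 1 - s m1 + s^2 m2 < 1 for s = m1 / (2 m2). Hence the probability of at most k triangles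
  is O(exp(-const * N^(1-sigma))), which is summable.
*)
theory Submission
  imports Defs "HOL-Real_Asymp.Real_Asymp"
begin

subsection \<open>Sums and products of independent Bernoulli variables\<close>

text \<open>For x = -y < 0 the bound follows from (1 - y + y^2)(1 + y) = 1 + y^3 >= 1 and 1 + y <=
  exp y. All negative x are needed: the block estimate applies it to an exponent without a uniform
  lower bound.\<close>

lemma exp_le_quadratic:
  fixes x :: real
  assumes "x \<le> 1"
  shows "exp x \<le> 1 + x + x\<^sup>2"
proof (cases "x \<ge> 0")
  case True
  then show ?thesis using exp_bound assms by auto
next
  case False
  define y where "y = - x"
  have y: "y > 0" using False by (simp add: y_def)
  have "0 \<le> (y - 1)\<^sup>2 + y\<^sup>2" by simp
  then have pos: "0 \<le> 1 - y + y\<^sup>2" by (simp add: power2_eq_square algebra_simps)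
  have "1 \<le> (1 - y + y\<^sup>2) * (1 + y)"
    using y by (simp add: algebra_simps power2_eq_square)
  also have "\<dots> \<le> (1 - y + y\<^sup>2) * exp y"
    using pos by (intro mult_left_mono) auto
  finally have "exp (- y) \<le> 1 - y + y\<^sup>2"
    by (simp add: exp_minus field_simps)
  then show ?thesis by (simp add: y_def)
qed

lemma summable_exp_neg_powr:
  fixes k s :: real
  assumes "k > 0" "s > 0"
  shows "summable (\<lambda>n. exp (- k * real (graph_size n) powr s))"
proof (rule summable_comparison_test_bigo)
  show "summable (\<lambda>n. norm (1 / real n ^ 2))"
    using inverse_power_summable[of 2, where 'a = real] by (simp add: field_simps)
  show "(\<lambda>n. exp (- k * real (graph_size n) powr s)) \<in> O(\<lambda>n. 1 / real n ^ 2)"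
    unfolding graph_size_def using assms by real_asymp
qed

text \<open>First Borel-Cantelli lemma, which asks for no independence between the events. The bound
  is required only eventually because the triangle estimate holds only for large n.\<close>

lemma (in prob_space) AE_eventually_not:
  assumes "\<And>n. {\<omega> \<in> space M. P n \<omega>} \<in> events"
    and "\<forall>\<^sub>F n in sequentially. prob {\<omega> \<in> space M. P n \<omega>} \<le> g n"
    and "summable g"
  shows "AE \<omega> in M. \<forall>\<^sub>F n in sequentially. \<not> P n \<omega>"
proof -
  have "summable (\<lambda>n. prob {\<omega> \<in> space M. P n \<omega>})"
    using assms(2) by (intro summable_comparison_test_ev[OF _ assms(3)]) simp
  then have "AE \<omega> in M. \<forall>\<^sub>F n in sequentially. \<omega> \<in> space M - {\<omega> \<in> space M. P n \<omega>}"
    using assms(1) by (intro borel_cantelli_AE1) (auto simp: emeasure_eq_measure)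
  then show ?thesis
    by eventually_elim (auto elim: eventually_mono)
qed

text \<open>One instance describes the edges of the graph for one fixed n. The values lie in {0, 1}
  at every sample point, so \<open>X i\<close> equals its own square pointwise and not just almost
  everywhere.\<close>

locale indep_bernoulli = prob_space M for M :: "'w measure" +
  fixes I :: "'i set" and X :: "'i \<Rightarrow> 'w \<Rightarrow> real" and p :: "'i \<Rightarrow> real"
  assumes fin: "finite I"
    and indep: "indep_vars (\<lambda>_. borel) X I"
    and vals: "i \<in> I \<Longrightarrow> \<omega> \<in> space M \<Longrightarrow> X i \<omega> \<in> {0, 1}"
    and prob_one: "i \<in> I \<Longrightarrow> prob {\<omega> \<in> space M. X i \<omega> = 1} = p i"
begin

lemma rv [measurable]: "i \<in> I \<Longrightarrow> random_variable borel (X i)"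
  using indep by (simp add: indep_vars_def)

lemma p_nonneg: "i \<in> I \<Longrightarrow> p i \<ge> 0"
  using prob_one[of i] by (metis measure_nonneg)

lemma expectation_X:
  assumes i: "i \<in> I"
  shows "integrable M (X i)" "expectation (X i) = p i"
proof -
  have [measurable]: "X i \<in> borel_measurable M" using rv[OF i] .
  show "integrable M (X i)"
    using vals[OF i] by (intro integrable_const_bound[where B = 1] AE_I2) fastforce+
  have "expectation (X i) = expectation (indicator {\<omega> \<in> space M. X i \<omega> = 1})"
    using vals[OF i] by (intro Bochner_Integration.integral_cong) (auto simp: indicator_def)
  then show "expectation (X i) = p i"
    using prob_one[OF i] by simp
qed

lemma expectation_prod:
  assumes "S \<subseteq> I"
  shows "integrable M (\<lambda>\<omega>. \<Prod>i\<in>S. X i \<omega>)" "expectation (\<lambda>\<omega>. \<Prod>i\<in>S. X i \<omega>) = (\<Prod>i\<in>S. p i)"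
proof -
  have S: "finite S" "indep_vars (\<lambda>_. borel) X S" "\<And>i. i \<in> S \<Longrightarrow> integrable M (X i)"
    using assms fin indep_vars_subset[OF indep] expectation_X by (auto intro: finite_subset)
  show "integrable M (\<lambda>\<omega>. \<Prod>i\<in>S. X i \<omega>)"
    by (rule indep_vars_integrable[OF S])
  show "expectation (\<lambda>\<omega>. \<Prod>i\<in>S. X i \<omega>) = (\<Prod>i\<in>S. p i)"
    using indep_vars_lebesgue_integral[OF S] assms expectation_X by (auto intro!: prod.cong)
qed

text \<open>On the two values 0 and 1 the function exp(t x) is at most 1 + (t + t^2) x, by
  \<open>exp_le_quadratic\<close>; independence then multiplies the factors. Negative t is included,
  so the bound serves both tails.\<close>

lemma mgf_sum_le:
  assumes t: "t \<le> 1"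
  shows "integrable M (\<lambda>\<omega>. exp (t * (\<Sum>i\<in>I. X i \<omega>)))"
    and "expectation (\<lambda>\<omega>. exp (t * (\<Sum>i\<in>I. X i \<omega>))) \<le> exp ((t + t\<^sup>2) * (\<Sum>i\<in>I. p i))"
proof -
  have ind: "indep_vars (\<lambda>_. borel) (\<lambda>i \<omega>. exp (t * X i \<omega>)) I"
    by (rule indep_vars_compose2[OF indep]) measurable
  have int: "integrable M (\<lambda>\<omega>. exp (t * X i \<omega>))" if i: "i \<in> I" for i
  proof -
    have [measurable]: "X i \<in> borel_measurable M" using rv[OF i] .
    show ?thesis
    proof (intro integrable_const_bound[where B = "exp \<bar>t\<bar>"] AE_I2)
      fix \<omega> assume "\<omega> \<in> space M"
      then show "norm (exp (t * X i \<omega>)) \<le> exp \<bar>t\<bar>" using vals[OF i] by fastforce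
    qed measurable
  qed
  have le: "expectation (\<lambda>\<omega>. exp (t * X i \<omega>)) \<le> exp ((t + t\<^sup>2) * p i)" if i: "i \<in> I" for i
  proof -
    have "expectation (\<lambda>\<omega>. exp (t * X i \<omega>)) \<le> expectation (\<lambda>\<omega>. 1 + (t + t\<^sup>2) * X i \<omega>)"
    proof (rule integral_mono)
      fix \<omega> assume "\<omega> \<in> space M"
      then consider "X i \<omega> = 0" | "X i \<omega> = 1" using vals[OF i] by blast
      then show "exp (t * X i \<omega>) \<le> 1 + (t + t\<^sup>2) * X i \<omega>"
        using exp_le_quadratic[OF t] by cases auto
    qed (use int[OF i] expectation_X[OF i] in auto)
    also have "\<dots> = 1 + (t + t\<^sup>2) * p i"
      using expectation_X[OF i] by (simp add: prob_space)
    also have "\<dots> \<le> exp ((t + t\<^sup>2) * p i)" by simp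
    finally show ?thesis .
  qed
  have eq: "exp (t * (\<Sum>i\<in>I. X i \<omega>)) = (\<Prod>i\<in>I. exp (t * X i \<omega>))" for \<omega>
    using fin by (simp add: sum_distrib_left exp_sum)
  show "integrable M (\<lambda>\<omega>. exp (t * (\<Sum>i\<in>I. X i \<omega>)))"
    unfolding eq by (rule indep_vars_integrable[OF fin ind int])
  have "expectation (\<lambda>\<omega>. exp (t * (\<Sum>i\<in>I. X i \<omega>))) = (\<Prod>i\<in>I. expectation (\<lambda>\<omega>. exp (t * X i \<omega>)))"
    unfolding eq by (rule indep_vars_lebesgue_integral[OF fin ind int])
  also have "\<dots> \<le> (\<Prod>i\<in>I. exp ((t + t\<^sup>2) * p i))"
    using le by (intro prod_mono) auto
  also have "\<dots> = exp ((t + t\<^sup>2) * (\<Sum>i\<in>I. p i))"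
    using fin by (simp add: sum_distrib_left exp_sum)
  finally show "expectation (\<lambda>\<omega>. exp (t * (\<Sum>i\<in>I. X i \<omega>))) \<le> exp ((t + t\<^sup>2) * (\<Sum>i\<in>I. p i))" .
qed

lemma sum_deviation_le:
  assumes t: "0 < t" "t \<le> 1"
  shows "prob {\<omega> \<in> space M. \<bar>(\<Sum>i\<in>I. X i \<omega>) - (\<Sum>i\<in>I. p i)\<bar> \<ge> e}
         \<le> 2 * exp (t\<^sup>2 * (\<Sum>i\<in>I. p i) - t * e)"
proof -
  define S where "S = (\<lambda>\<omega>. \<Sum>i\<in>I. X i \<omega>)"
  define \<mu> where "\<mu> = (\<Sum>i\<in>I. p i)"
  have [measurable]: "S \<in> borel_measurable M"
    unfolding S_def using rv by auto
  have mgf: "integrable M (\<lambda>\<omega>. exp (u * S \<omega>))" "expectation (\<lambda>\<omega>. exp (u * S \<omega>)) \<le> exp ((u + u\<^sup>2) * \<mu>)"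
    if "u \<le> 1" for u
    using mgf_sum_le[OF that] by (simp_all add: S_def \<mu>_def)
  \<comment> \<open>Taking u = t gives the upper tail and u = -t the lower one. The linear terms
    cancel, (u + u^2) \<open>\<mu>\<close> - u \<open>\<mu>\<close> = u^2 \<open>\<mu>\<close>, so
    both tails have the same bound.\<close>
  have tail: "prob {\<omega> \<in> space M. u * S \<omega> \<ge> u * \<mu> + t * e} \<le> exp (t\<^sup>2 * \<mu> - t * e)"
    if u: "u \<le> 1" "u\<^sup>2 = t\<^sup>2" for u
  proof -
    have "prob {\<omega> \<in> space M. u * S \<omega> \<ge> u * \<mu> + t * e}
        = prob {\<omega> \<in> space M. exp (u * S \<omega>) \<ge> exp (u * \<mu> + t * e)}" by simp
    also have "\<dots> \<le> expectation (\<lambda>\<omega>. exp (u * S \<omega>)) / exp (u * \<mu> + t * e)"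
      by (rule integral_Markov_inequality_measure[where A = "{}"]) (use mgf[OF u(1)] in auto)
    also have "\<dots> \<le> exp ((u + u\<^sup>2) * \<mu>) / exp (u * \<mu> + t * e)"
      using mgf[OF u(1)] by (intro divide_right_mono) auto
    also have "\<dots> = exp (t\<^sup>2 * \<mu> - t * e)"
      by (simp add: u(2) exp_diff[symmetric] algebra_simps)
    finally show ?thesis .
  qed
  have "prob {\<omega> \<in> space M. \<bar>S \<omega> - \<mu>\<bar> \<ge> e}
      \<le> prob ({\<omega> \<in> space M. t * S \<omega> \<ge> t * \<mu> + t * e} \<union> {\<omega> \<in> space M. (-t) * S \<omega> \<ge> (-t) * \<mu> + t * e})"
  proof (rule finite_measure_mono)
    show "{\<omega> \<in> space M. \<bar>S \<omega> - \<mu>\<bar> \<ge> e} \<subseteq> {\<omega> \<in> space M. t * S \<omega> \<ge> t * \<mu> + t * e} \<union> {\<omega> \<in> space M. (-t) * S \<omega> \<ge> (-t) * \<mu> + t * e}"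
    proof safe
      fix \<omega> assume "e \<le> \<bar>S \<omega> - \<mu>\<bar>" "\<not> - t * \<mu> + t * e \<le> - t * S \<omega>"
      then have "t * e > t * (\<mu> - S \<omega>)" by (simp add: algebra_simps)
      then have "e > \<mu> - S \<omega>" using t(1) by simp
      with \<open>e \<le> \<bar>S \<omega> - \<mu>\<bar>\<close> have "e \<le> S \<omega> - \<mu>" by linarith
      then have "t * e \<le> t * (S \<omega> - \<mu>)" using t(1) by (intro mult_left_mono) auto
      then show "t * \<mu> + t * e \<le> t * S \<omega>" by (simp add: algebra_simps)
    qed
  qed measurable
  also have "\<dots> \<le> prob {\<omega> \<in> space M. t * S \<omega> \<ge> t * \<mu> + t * e} + prob {\<omega> \<in> space M. (-t) * S \<omega> \<ge> (-t) * \<mu> + t * e}"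
    by (rule measure_Un_le) measurable
  also have "\<dots> \<le> 2 * exp (t\<^sup>2 * \<mu> - t * e)"
    using tail[of t] tail[of "-t"] t by simp
  finally show ?thesis by (simp add: S_def \<mu>_def)
qed

text \<open>A common factor is 0 or 1 and may be counted once. This turns the square of a triangle
  count into a sum over unions of edge sets, whose expectations are again products.\<close>

lemma prod_Un_of_values:
  assumes "S \<subseteq> I" "T \<subseteq> I" "\<omega> \<in> space M"
  shows "(\<Prod>i\<in>S. X i \<omega>) * (\<Prod>i\<in>T. X i \<omega>) = (\<Prod>i\<in>S \<union> T. X i \<omega>)"
proof -
  have f: "finite S" "finite T" using assms fin by (auto intro: finite_subset)
  have v: "X i \<omega> = 0 \<or> X i \<omega> = 1" if "i \<in> S \<union> T" for i
    using vals[of i \<omega>] that assms by auto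
  show ?thesis
  proof (cases "\<exists>i\<in>S \<union> T. X i \<omega> = 0")
    case True
    then have "(\<Prod>i\<in>S \<union> T. X i \<omega>) = 0" using f by (intro prod_zero) auto
    moreover have "(\<Prod>i\<in>S. X i \<omega>) = 0 \<or> (\<Prod>i\<in>T. X i \<omega>) = 0"
      using True f by (auto intro: prod_zero)
    ultimately show ?thesis by auto
  next
    case False
    then have "X i \<omega> = 1" if "i \<in> S \<union> T" for i using v[OF that] that by auto
    then show ?thesis by simp
  qed
qed

text \<open>A Chernoff bound with b for a block, t for a pattern in it and \<open>E t\<close> for
  the edges of t. Blocks use disjoint sets of edges, so their counts are independent; inside a block
  any dependence is allowed, since only two moments of its count enter.\<close>

lemma block_count_lower_tail:
  fixes B :: "'b set" and F :: "'b \<Rightarrow> 't set" and E :: "'t \<Rightarrow> 'i set"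
  assumes B: "finite B"
    and F: "\<And>b. b \<in> B \<Longrightarrow> finite (F b)"
    and E: "\<And>b t. b \<in> B \<Longrightarrow> t \<in> F b \<Longrightarrow> E t \<subseteq> I"
    and disj: "disjoint_family_on (\<lambda>b. \<Union> (E ` F b)) B"
    and m1: "\<And>b. b \<in> B \<Longrightarrow> m1 \<le> (\<Sum>t\<in>F b. \<Prod>i\<in>E t. p i)"
    and m2: "\<And>b. b \<in> B \<Longrightarrow> (\<Sum>t\<in>F b. \<Sum>u\<in>F b. \<Prod>i\<in>E t \<union> E u. p i) \<le> m2"
    and pos: "m1 > 0" "m2 > 0"
  shows "prob {\<omega> \<in> space M. (\<Sum>b\<in>B. \<Sum>t\<in>F b. \<Prod>i\<in>E t. X i \<omega>) \<le> x}
         \<le> exp (m1 / (2 * m2) * x - real (card B) * (m1\<^sup>2 / (4 * m2)))"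
proof -
  define K where "K = (\<lambda>b. \<Union> (E ` F b))"
  define g where "g = (\<lambda>b (f :: 'i \<Rightarrow> real). \<Sum>t\<in>F b. \<Prod>i\<in>E t. f i)"
  define Y where "Y = (\<lambda>b \<omega>. g b (\<lambda>i. X i \<omega>))"
  \<comment> \<open>This s minimises 1 - s \<open>m1\<close> + s^2 \<open>m2\<close>; the minimum is
    1 - \<open>m1\<close>^2 / (4 \<open>m2\<close>).\<close>
  define s where "s = m1 / (2 * m2)"
  have s: "s > 0" using pos by (simp add: s_def)
  have K: "K b \<subseteq> I" if "b \<in> B" for b
    using E[OF that] by (auto simp: K_def)
  have EK: "E t \<subseteq> K b" if "t \<in> F b" for b t
    using that by (auto simp: K_def)
  \<comment> \<open>Grouping the edges by block gives independent random vectors. The count of a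
    block is a measurable function of its own vector, and restricting to \<open>K b\<close> does not
    change it.\<close>
  have "indep_vars (\<lambda>b. PiM (K b) (\<lambda>_. borel)) (\<lambda>b \<omega>. restrict (\<lambda>i. X i \<omega>) (K b)) B"
    using disj K by (intro indep_vars_restrict[OF indep]) (auto simp: K_def)
  then have "indep_vars (\<lambda>_. borel) (\<lambda>b \<omega>. exp (- s * g b (restrict (\<lambda>i. X i \<omega>) (K b)))) B"
  proof (rule indep_vars_compose2[where Y = "\<lambda>b f. exp (- s * g b f)"])
    fix b assume "b \<in> B"
    have "(\<lambda>f. f i) \<in> borel_measurable (PiM (K b) (\<lambda>_. borel :: real measure))"
      if "t \<in> F b" "i \<in> E t" for t i
      using EK[OF that(1)] that(2) by (intro measurable_component_singleton) auto
    then have [measurable]: "g b \<in> borel_measurable (PiM (K b) (\<lambda>_. borel))"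
      unfolding g_def by (intro borel_measurable_sum borel_measurable_prod) auto
    show "(\<lambda>f. exp (- s * g b f)) \<in> borel_measurable (PiM (K b) (\<lambda>_. borel))"
      by measurable
  qed
  moreover have "g b (restrict (\<lambda>i. X i \<omega>) (K b)) = Y b \<omega>" for b \<omega>
    unfolding g_def Y_def using EK by (intro sum.cong prod.cong) auto
  ultimately have ind: "indep_vars (\<lambda>_. borel) (\<lambda>b \<omega>. exp (- s * Y b \<omega>)) B"
    by simp
  have X_nonneg: "X i \<omega> \<ge> 0" if "i \<in> I" "\<omega> \<in> space M" for i \<omega>
    using vals[OF that] by auto
  have Y_nonneg: "Y b \<omega> \<ge> 0" if "b \<in> B" "\<omega> \<in> space M" for b \<omega>
    unfolding Y_def g_def using X_nonneg[OF _ that(2)] E[OF that(1)]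
    by (intro sum_nonneg prod_nonneg) auto
  have Y_meas: "Y b \<in> borel_measurable M" if "b \<in> B" for b
    unfolding Y_def g_def using E[OF that]
    by (intro borel_measurable_sum borel_measurable_prod rv) auto
  have int: "integrable M (\<lambda>\<omega>. exp (- s * Y b \<omega>))" if b: "b \<in> B" for b
  proof (intro integrable_const_bound[where B = 1] AE_I2)
    fix \<omega> assume "\<omega> \<in> space M"
    then show "norm (exp (- s * Y b \<omega>)) \<le> 1"
      using Y_nonneg[OF b] s by simp
  qed (use Y_meas[OF b] in measurable)
  have le: "expectation (\<lambda>\<omega>. exp (- s * Y b \<omega>)) \<le> exp (- (m1\<^sup>2 / (4 * m2)))" if b: "b \<in> B" for b
  proof -
    have Y1: "has_bochner_integral M (Y b) (\<Sum>t\<in>F b. \<Prod>i\<in>E t. p i)"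
      unfolding Y_def g_def using E[OF b] expectation_prod
      by (intro has_bochner_integral_sum) (auto simp: has_bochner_integral_iff)
    have "has_bochner_integral M (\<lambda>\<omega>. \<Sum>t\<in>F b. \<Sum>u\<in>F b. \<Prod>i\<in>E t \<union> E u. X i \<omega>)
        (\<Sum>t\<in>F b. \<Sum>u\<in>F b. \<Prod>i\<in>E t \<union> E u. p i)"
      using E[OF b] expectation_prod
      by (intro has_bochner_integral_sum) (auto simp: has_bochner_integral_iff)
    moreover have "(\<Sum>t\<in>F b. \<Sum>u\<in>F b. \<Prod>i\<in>E t \<union> E u. X i \<omega>) = (Y b \<omega>)\<^sup>2" if "\<omega> \<in> space M" for \<omega>
      unfolding Y_def g_def power2_eq_square sum_product
      using prod_Un_of_values[OF E[OF b] E[OF b] that] by (intro sum.cong) auto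
    ultimately have Y2: "has_bochner_integral M (\<lambda>\<omega>. (Y b \<omega>)\<^sup>2) (\<Sum>t\<in>F b. \<Sum>u\<in>F b. \<Prod>i\<in>E t \<union> E u. p i)"
      by (subst has_bochner_integral_cong[OF refl _ refl]) auto
    have "expectation (\<lambda>\<omega>. exp (- s * Y b \<omega>)) \<le> expectation (\<lambda>\<omega>. 1 - s * Y b \<omega> + s\<^sup>2 * (Y b \<omega>)\<^sup>2)"
    proof (rule integral_mono)
      fix \<omega> assume "\<omega> \<in> space M"
      then have "- s * Y b \<omega> \<le> 0" using Y_nonneg[OF b] s by simp
      then show "exp (- s * Y b \<omega>) \<le> 1 - s * Y b \<omega> + s\<^sup>2 * (Y b \<omega>)\<^sup>2"
        using exp_le_quadratic[of "- s * Y b \<omega>"] by (simp add: power_mult_distrib)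
    qed (use int[OF b] Y1 Y2 in \<open>auto simp: has_bochner_integral_iff\<close>)
    also have "\<dots> = 1 - s * (\<Sum>t\<in>F b. \<Prod>i\<in>E t. p i) + s\<^sup>2 * (\<Sum>t\<in>F b. \<Sum>u\<in>F b. \<Prod>i\<in>E t \<union> E u. p i)"
      using Y1 Y2 by (simp add: has_bochner_integral_iff prob_space)
    also have "\<dots> \<le> 1 - s * m1 + s\<^sup>2 * m2"
      using m1[OF b] m2[OF b] s by (intro add_mono diff_mono mult_left_mono) auto
    also have "\<dots> = 1 + (- (m1\<^sup>2 / (4 * m2)))"
      using pos by (simp add: s_def field_simps power2_eq_square)
    also have "\<dots> \<le> exp (- (m1\<^sup>2 / (4 * m2)))"
      by (rule exp_ge_add_one_self)
    finally show ?thesis .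
  qed
  have eq: "exp (- s * (\<Sum>b\<in>B. Y b \<omega>)) = (\<Prod>b\<in>B. exp (- s * Y b \<omega>))" for \<omega>
    using B by (simp only: sum_distrib_left exp_sum)
  have "prob {\<omega> \<in> space M. (\<Sum>b\<in>B. Y b \<omega>) \<le> x}
      = prob {\<omega> \<in> space M. exp (- s * (\<Sum>b\<in>B. Y b \<omega>)) \<ge> exp (- s * x)}"
    using s by simp
  also have "\<dots> \<le> expectation (\<lambda>\<omega>. exp (- s * (\<Sum>b\<in>B. Y b \<omega>))) / exp (- s * x)"
    unfolding eq
    by (rule integral_Markov_inequality_measure[where A = "{}"])
       (use indep_vars_integrable[OF B ind int] in \<open>auto intro!: AE_I2 prod_nonneg\<close>)
  also have "expectation (\<lambda>\<omega>. exp (- s * (\<Sum>b\<in>B. Y b \<omega>))) = (\<Prod>b\<in>B. expectation (\<lambda>\<omega>. exp (- s * Y b \<omega>)))"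
    unfolding eq by (rule indep_vars_lebesgue_integral[OF B ind int])
  also have "\<dots> \<le> (\<Prod>b\<in>B. exp (- (m1\<^sup>2 / (4 * m2))))"
    using le by (intro prod_mono) auto
  also have "\<dots> = exp (- real (card B) * (m1\<^sup>2 / (4 * m2)))"
    by (simp add: exp_of_nat_mult[symmetric])
  finally show ?thesis
    by (simp add: Y_def g_def s_def exp_diff exp_minus field_simps divide_right_mono)
qed

end

subsection \<open>Edges and triangles as sums\<close>

lemma finite_vertices [simp]: "finite (vertices n)"
  by (simp add: vertices_def)

lemma edge_pairs_subset: "edge_pairs n \<subseteq> vertices n \<times> vertices n"
  by (auto simp: edge_pairs_def)

lemma finite_edge_pairs [simp]: "finite (edge_pairs n)"
  using edge_pairs_subset by (rule finite_subset) simp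

lemma sum_index_vertices: "(\<Sum>k<graph_size n. f (int k - int n)) = (\<Sum>x\<in>vertices n. f x)"
  by (rule sum.reindex_bij_witness[where j = "\<lambda>k. int k - int n" and i = "\<lambda>x. nat (x + int n)"])
     (auto simp: graph_size_def vertices_def)

text \<open>Each unordered pair occurs twice in the symmetric double sum, which cancels the factor
  1/2.\<close>

lemma avg_degree_eq:
  "avg_degree n a \<omega> = (\<Sum>e\<in>edge_pairs n. a e \<omega>) / real (graph_size n)"
proof -
  let ?V = "vertices n"
  have *: "(\<Sum>i\<in>?V. \<Sum>j\<in>?V. if i < j then a (i, j) \<omega> else 0) = (\<Sum>e\<in>edge_pairs n. a e \<omega>)"
  proof -
    have "(\<Sum>i\<in>?V. \<Sum>j\<in>?V. if i < j then a (i, j) \<omega> else 0)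
        = (\<Sum>(i, j)\<in>?V \<times> ?V. if i < j then a (i, j) \<omega> else 0)"
      by (rule sum.cartesian_product)
    also have "\<dots> = (\<Sum>e\<in>edge_pairs n. a e \<omega>)"
      by (rule sum.mono_neutral_cong_right) (auto simp: edge_pairs_def split: if_splits)
    finally show ?thesis .
  qed
  have "(\<Sum>i\<in>?V. \<Sum>j\<in>?V. adj_entry a \<omega> i j)
      = (\<Sum>i\<in>?V. \<Sum>j\<in>?V. (if i < j then a (i, j) \<omega> else 0) + (if j < i then a (j, i) \<omega> else 0))"
    by (intro sum.cong) (auto simp: adj_entry_def)
  also have "\<dots> = (\<Sum>i\<in>?V. \<Sum>j\<in>?V. if i < j then a (i, j) \<omega> else 0)
      + (\<Sum>j\<in>?V. \<Sum>i\<in>?V. if j < i then a (j, i) \<omega> else 0)"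
    by (subst (2) sum.swap) (simp add: sum.distrib)
  also have "\<dots> = 2 * (\<Sum>e\<in>edge_pairs n. a e \<omega>)"
    unfolding * by simp
  finally show ?thesis by (simp add: avg_degree_def)
qed

text \<open>The diagonal entry of the cube at x is the sum over z of (A^2)(x, z) A(z, x). This puts
  the intermediate vertex y of the square innermost, hence the order x, z, y.\<close>

lemma triangles_eq:
  "triangles n a \<omega> = 1 / 6 * (\<Sum>x\<in>vertices n. \<Sum>z\<in>vertices n. \<Sum>y\<in>vertices n.
     adj_entry a \<omega> x y * adj_entry a \<omega> y z * adj_entry a \<omega> z x)"
proof -
  define A where "A = adj_matrix n a \<omega>"
  let ?N = "graph_size n" and ?e = "\<lambda>k l. adj_entry a \<omega> (int k - int n) (int l - int n)"
  have dim: "dim_row A = ?N" "dim_col A = ?N" by (simp_all add: A_def adj_matrix_def)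
  have ent: "A $$ (k, l) = ?e k l" if "k < ?N" "l < ?N" for k l
    using that by (simp add: A_def adj_matrix_def)
  have "(A ^\<^sub>m 3) $$ (k, k) = (\<Sum>l<?N. \<Sum>m<?N. ?e k m * ?e m l * ?e l k)" if k: "k < ?N" for k
    using k by (simp add: numeral_3_eq_3 dim scalar_prod_def ent atLeast0LessThan sum_distrib_right)
  then have "mat_trace (A ^\<^sub>m 3) = (\<Sum>k<?N. \<Sum>l<?N. \<Sum>m<?N. ?e k m * ?e m l * ?e l k)"
    by (simp add: mat_trace_def dim)
  also have "\<dots> = (\<Sum>x\<in>vertices n. \<Sum>z\<in>vertices n. \<Sum>y\<in>vertices n.
     adj_entry a \<omega> x y * adj_entry a \<omega> y z * adj_entry a \<omega> z x)"
    by (simp add: sum_index_vertices[symmetric])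
  finally show ?thesis by (simp add: triangles_def A_def)
qed

text \<open>The trace counts a triangle once for each of its six vertex orderings, and only the
  increasing one is kept. The lost factor 6 is harmless because only divergence is at stake.\<close>

lemma triangles_ge:
  assumes nonneg: "\<And>e. e \<in> edge_pairs n \<Longrightarrow> a e \<omega> \<ge> 0"
    and T: "\<And>x y z. (x, y, z) \<in> T \<Longrightarrow> x \<in> vertices n \<and> z \<in> vertices n \<and> x < y \<and> y < z"
  shows "1 / 6 * (\<Sum>(x, y, z)\<in>T. a (x, y) \<omega> * a (x, z) \<omega> * a (y, z) \<omega>) \<le> triangles n a \<omega>"
proof -
  let ?V = "vertices n" and ?e = "adj_entry a \<omega>"
  have e: "?e x y \<ge> 0" if "x \<in> ?V" "y \<in> ?V" for x y
    using that nonneg by (auto simp: adj_entry_def edge_pairs_def)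
  have sub: "T \<subseteq> {(x, y, z). (x, z, y) \<in> ?V \<times> ?V \<times> ?V}"
    using T by (fastforce simp: vertices_def)
  have "(\<Sum>(x, y, z)\<in>T. a (x, y) \<omega> * a (x, z) \<omega> * a (y, z) \<omega>)
      = (\<Sum>(x, y, z)\<in>T. ?e x y * ?e y z * ?e z x)"
    using T by (intro sum.cong) (fastforce simp: adj_entry_def)+
  also have "\<dots> = (\<Sum>(x, z, y)\<in>(\<lambda>(x, y, z). (x, z, y)) ` T. ?e x y * ?e y z * ?e z x)"
    by (subst sum.reindex) (auto simp: inj_on_def case_prod_unfold)
  also have "\<dots> \<le> (\<Sum>(x, z, y)\<in>?V \<times> ?V \<times> ?V. ?e x y * ?e y z * ?e z x)"
    using sub e by (intro sum_mono2) (auto intro!: mult_nonneg_nonneg)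
  also have "\<dots> = (\<Sum>x\<in>?V. \<Sum>z\<in>?V. \<Sum>y\<in>?V. ?e x y * ?e y z * ?e z x)"
    by (simp add: sum.cartesian_product)
  finally show ?thesis by (simp add: triangles_eq)
qed

text \<open>Pairs are grouped by their difference d, and exactly N - d pairs have difference
  d.\<close>

lemma sum_edge_pairs_diff:
  fixes f :: "int \<Rightarrow> real"
  shows "(\<Sum>(i, j)\<in>edge_pairs n. f (j - i))
    = (\<Sum>d\<in>{1..<graph_size n}. (real (graph_size n) - real d) * f (int d))"
proof -
  have "(\<Sum>(i, j)\<in>edge_pairs n. f (j - i))
      = (\<Sum>(d, i)\<in>(SIGMA d:{1..<graph_size n}. {- int n..int n - int d}). f (int d))"
    by (rule sum.reindex_bij_witness[where j = "\<lambda>(i, j). (nat (j - i), i)" and i = "\<lambda>(d, i). (i, i + int d)"])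
       (auto simp: edge_pairs_def vertices_def graph_size_def)
  also have "\<dots> = (\<Sum>d\<in>{1..<graph_size n}. \<Sum>i\<in>{- int n..int n - int d}. f (int d))"
    by (rule sum.Sigma[symmetric]) auto
  also have "\<dots> = (\<Sum>d\<in>{1..<graph_size n}. (real (graph_size n) - real d) * f (int d))"
    by (intro sum.cong) (auto simp: graph_size_def of_nat_diff)
  finally show ?thesis .
qed

subsection \<open>Riemann sums on the half-line\<close>

text \<open>The sum is the integral of the step function \<open>g n\<close>, whose cells have length
  1 / R. Its value is taken at the right end of each cell, so it lies below the decreasing h. At
  fixed t the relevant index is about t R = o(N), so the taper tends to 1.\<close>

lemma tapered_riemann_sum_tendsto:
  fixes h :: "real \<Rightarrow> real" and R :: "nat \<Rightarrow> real" and N :: "nat \<Rightarrow> nat"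
  assumes nonneg: "\<And>t. h t \<ge> 0"
    and anti: "\<And>s t. 0 \<le> s \<Longrightarrow> s \<le> t \<Longrightarrow> h t \<le> h s"
    and cont: "continuous_on UNIV h"
    and int: "integrable lborel h"
    and R: "\<And>n. R n > 0" "filterlim R at_top sequentially"
    and RN: "(\<lambda>n. R n / real (N n)) \<longlonglongrightarrow> 0"
    and N: "\<And>n. N n > 0"
  shows "(\<lambda>n. \<Sum>d\<in>{1..<N n}. (1 - real d / real (N n)) * h (real d / R n) / R n)
         \<longlonglongrightarrow> (\<integral>t. indicator {0<..} t * h t \<partial>lborel)"
proof -
  define w where "w = (\<lambda>n d. (1 - real d / real (N n)) * h (real d / R n))"
  define J where "J = (\<lambda>n d. {(real d - 1) / R n<..real d / R n})"
  define g where "g = (\<lambda>n t. \<Sum>d\<in>{1..<N n}. w n d * indicator (J n d) t)"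
  \<comment> \<open>A point lies in at most one cell of the sum, with index given by the ceiling; so
    \<open>g n t\<close> reduces to a single term.\<close>
  have J_iff: "t \<in> J n d \<longleftrightarrow> \<lceil>t * R n\<rceil> = int d" for n d t
  proof -
    have "\<lceil>t * R n\<rceil> = int d \<longleftrightarrow> real d - 1 < t * R n \<and> t * R n \<le> real d"
      by (simp add: ceiling_eq_iff)
    then show ?thesis
      using R(1)[of n] by (simp add: J_def field_simps)
  qed
  have g_eq: "g n t = (if t > 0 \<and> nat \<lceil>t * R n\<rceil> < N n then w n (nat \<lceil>t * R n\<rceil>) else 0)" for n t
  proof -
    have "g n t = (\<Sum>d\<in>{1..<N n}. if nat \<lceil>t * R n\<rceil> = d then w n d else 0)"
      unfolding g_def
    proof (rule sum.cong)
      fix d assume "d \<in> {1..<N n}"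
      then have "k = int d \<longleftrightarrow> nat k = d" for k by auto
      then have "t \<in> J n d \<longleftrightarrow> nat \<lceil>t * R n\<rceil> = d"
        unfolding J_iff .
      then show "w n d * indicator (J n d) t = (if nat \<lceil>t * R n\<rceil> = d then w n d else 0)"
        by (simp add: indicator_def)
    qed simp
    also have "\<dots> = (if nat \<lceil>t * R n\<rceil> \<in> {1..<N n} then w n (nat \<lceil>t * R n\<rceil>) else 0)"
      by (simp add: sum.delta')
    \<comment> \<open>For t <= 0 the ceiling is nonpositive and \<open>nat\<close> sends it to 0,
      which is outside the index range starting at 1.\<close>
    also have "nat \<lceil>t * R n\<rceil> \<in> {1..<N n} \<longleftrightarrow> t > 0 \<and> nat \<lceil>t * R n\<rceil> < N n"
      using R(1)[of n] by (auto simp: Suc_le_eq zero_less_mult_iff)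
    finally show ?thesis .
  qed
  have h_meas [measurable]: "h \<in> borel_measurable borel"
    using cont by (rule borel_measurable_continuous_onI)
  have lim: "(\<lambda>n. g n t) \<longlonglongrightarrow> indicator {0<..} t * h t" for t
  proof (cases "t > 0")
    case False
    then show ?thesis by (simp add: g_eq)
  next
    case True
    define D where "D = (\<lambda>n. nat \<lceil>t * R n\<rceil>)"
    have D: "t \<le> real (D n) / R n" "real (D n) / R n \<le> t + 1 / R n" for n
    proof -
      have "real (D n) = of_int \<lceil>t * R n\<rceil>"
        using True R(1)[of n] by (simp add: D_def)
      then have "t * R n \<le> real (D n)" "real (D n) \<le> t * R n + 1"
        by linarith+
      then show "t \<le> real (D n) / R n" "real (D n) / R n \<le> t + 1 / R n"
        using R(1)[of n] by (simp_all add: field_simps)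
    qed
    have "(\<lambda>n. t + 1 / R n) \<longlonglongrightarrow> t + 0"
      by (intro tendsto_add tendsto_const tendsto_divide_0[OF tendsto_const]
          filterlim_at_top_imp_at_infinity[OF R(2)])
    then have "(\<lambda>n. t + 1 / R n) \<longlonglongrightarrow> t" by simp
    then have DR: "(\<lambda>n. real (D n) / R n) \<longlonglongrightarrow> t"
      by (rule tendsto_sandwich[OF always_eventually[OF allI[OF D(1)]] always_eventually[OF allI[OF D(2)]] tendsto_const])
    have "(\<lambda>n. (real (D n) / R n) * (R n / real (N n))) \<longlonglongrightarrow> t * 0"
      by (intro tendsto_mult DR RN)
    moreover have "(real (D n) / R n) * (R n / real (N n)) = real (D n) / real (N n)" for n
      using R(1)[of n] by simp
    ultimately have DN: "(\<lambda>n. real (D n) / real (N n)) \<longlonglongrightarrow> 0" by (simp only: mult_zero_right)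
    have "(\<lambda>n. h (real (D n) / R n)) \<longlonglongrightarrow> h t"
      using cont DR by (rule continuous_on_tendsto_compose) auto
    then have "(\<lambda>n. (1 - real (D n) / real (N n)) * h (real (D n) / R n)) \<longlonglongrightarrow> (1 - 0) * h t"
      using DN by (intro tendsto_intros)
    moreover have "\<forall>\<^sub>F n in sequentially. real (D n) / real (N n) < 1"
      using order_tendstoD(2)[OF DN, of 1] by simp
    then have "\<forall>\<^sub>F n in sequentially. (1 - real (D n) / real (N n)) * h (real (D n) / R n) = g n t"
    proof eventually_elim
      case (elim n)
      then have "D n < N n" using N[of n] by (simp add: field_simps)
      then show ?case using True by (simp add: g_eq w_def D_def)
    qed
    ultimately have "(\<lambda>n. g n t) \<longlonglongrightarrow> (1 - 0) * h t"
      by (rule Lim_transform_eventually)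
    then show ?thesis using True by simp
  qed
  have bound: "norm (g n t) \<le> indicator {0<..} t * h t" for n t
  proof (cases "t > 0 \<and> nat \<lceil>t * R n\<rceil> < N n")
    case False
    then show ?thesis using nonneg by (auto simp: g_eq)
  next
    case True
    define D where "D = nat \<lceil>t * R n\<rceil>"
    have D: "t * R n \<le> real D" "D < N n" "t > 0"
      using True by (auto simp: D_def real_nat_ceiling_ge)
    have "h (real D / R n) \<le> h t"
      using D R(1)[of n] by (intro anti) (auto simp: field_simps)
    moreover have "0 \<le> 1 - real D / real (N n)" "1 - real D / real (N n) \<le> 1"
      using D(2) N[of n] by (auto simp: field_simps)
    ultimately have "\<bar>w n D\<bar> \<le> 1 * h t"
      unfolding w_def abs_mult using nonneg by (intro mult_mono) auto
    then show ?thesis using D by (simp add: g_eq D_def)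
  qed
  have "(\<lambda>n. \<integral>t. g n t \<partial>lborel) \<longlonglongrightarrow> (\<integral>t. indicator {0<..} t * h t \<partial>lborel)"
  proof (rule integral_dominated_convergence)
    show "integrable lborel (\<lambda>t. indicator {0<..} t * h t)"
      using integrable_real_mult_indicator[OF _ int, of "{0<..}"] by (simp add: mult.commute)
    show "g n \<in> borel_measurable lborel" for n
      unfolding g_def J_def by measurable
  qed (use lim bound in auto)
  moreover have "(\<integral>t. g n t \<partial>lborel) = (\<Sum>d\<in>{1..<N n}. (1 - real d / real (N n)) * h (real d / R n) / R n)" for n
  proof -
    have J: "emeasure lborel (J n d) = ennreal (1 / R n)" for d
      using R(1)[of n] by (simp add: J_def divide_right_mono diff_divide_distrib[symmetric])
    then have "(\<integral>t. g n t \<partial>lborel) = (\<Sum>d\<in>{1..<N n}. w n d * (1 / R n))"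
      unfolding g_def using R(1)[of n]
      by (subst Bochner_Integration.integral_sum) (auto simp: J_def measure_def)
    then show ?thesis by (simp add: w_def)
  qed
  ultimately show ?thesis by simp
qed

text \<open>Reflection exchanges the two open half-lines, and the origin is a null set.\<close>

lemma integral_even_half:
  fixes h :: "real \<Rightarrow> real"
  assumes even: "\<And>t. h (- t) = h t" and int: "integrable lborel h"
  shows "(\<integral>t. indicator {0<..} t * h t \<partial>lborel) = (\<integral>t. h t \<partial>lborel) / 2"
proof -
  have i: "integrable lborel (\<lambda>t. indicator A t * h t)" if "A \<in> sets borel" for A
    using integrable_real_mult_indicator[OF _ int, of A] that by (simp add: mult.commute)
  have "(\<integral>t. indicator {0<..} t * h t \<partial>lborel) = (\<integral>t. indicator {..<0} t * h t \<partial>lborel)"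
    by (subst lborel_integral_real_affine[where c = "-1" and t = 0])
       (auto simp: even indicator_def intro!: Bochner_Integration.integral_cong)
  moreover have "(\<integral>t. indicator {0<..} t * h t \<partial>lborel) + (\<integral>t. indicator {..<0} t * h t \<partial>lborel)
      = (\<integral>t. indicator {0<..} t * h t + indicator {..<0} t * h t \<partial>lborel)"
    using i by (subst Bochner_Integration.integral_add) auto
  moreover have "\<dots> = (\<integral>t. h t \<partial>lborel)"
  proof (rule integral_cong_AE)
    show "AE t in lborel. indicator {0<..} t * h t + indicator {..<0} t * h t = h t"
      using AE_lborel_singleton[of 0] by eventually_elim (auto simp: indicator_def)
  qed (use int i in auto)
  ultimately show ?thesis by simp
qed

subsection \<open>Triangles in disjoint blocks\<close>

definition tri_edges :: "int \<times> int \<times> int \<Rightarrow> (int \<times> int) set" where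
  "tri_edges = (\<lambda>(x, y, z). {(x, y), (x, z), (y, z)})"

text \<open>With one vertex in each of three consecutive intervals, every triple is automatically
  increasing, and an edge reveals which two thirds it joins. This keeps the overlaps of two
  triangles easy to classify.\<close>

definition tripartite_block :: "int \<Rightarrow> nat \<Rightarrow> (int \<times> int \<times> int) set" where
  "tripartite_block v L = {v..<v + int L} \<times> {v + int L..<v + 2 * int L} \<times> {v + 2 * int L..<v + 3 * int L}"

lemma finite_tripartite_block [simp]: "finite (tripartite_block v L)"
  by (simp add: tripartite_block_def)

lemma card_tripartite_block [simp]: "card (tripartite_block v L) = L ^ 3"
  by (simp add: tripartite_block_def card_cartesian_product power3_eq_cube)

lemma tri_edges_block:
  assumes "t \<in> tripartite_block v L" "(i, j) \<in> tri_edges t"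
  shows "v \<le> i" "i < j" "j < v + 3 * int L"
  using assms by (auto simp: tripartite_block_def tri_edges_def)

lemma prod_tri_edges:
  fixes f :: "int \<times> int \<Rightarrow> real"
  assumes "x < y" "y < z"
  shows "(\<Prod>e\<in>tri_edges (x, y, z). f e) = f (x, y) * f (x, z) * f (y, z)"
  using assms by (simp add: tri_edges_def mult.assoc)

lemma block_first_moment:
  fixes p :: "int \<times> int \<Rightarrow> real"
  assumes q: "q \<ge> 0"
    and p: "\<And>i j. v \<le> i \<Longrightarrow> i < j \<Longrightarrow> j < v + 3 * int L \<Longrightarrow> q \<le> p (i, j)"
  shows "(real L * q) ^ 3 \<le> (\<Sum>t\<in>tripartite_block v L. \<Prod>e\<in>tri_edges t. p e)"
proof -
  have "(real L * q) ^ 3 = (\<Sum>t\<in>tripartite_block v L. q ^ 3)"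
    by (simp add: power_mult_distrib)
  also have "\<dots> \<le> (\<Sum>t\<in>tripartite_block v L. \<Prod>e\<in>tri_edges t. p e)"
  proof (rule sum_mono)
    fix t assume t: "t \<in> tripartite_block v L"
    obtain x y z where xyz: "t = (x, y, z)" by (cases t)
    have xy: "x < y" "y < z" "v \<le> x" "z < v + 3 * int L"
      using t by (auto simp: xyz tripartite_block_def)
    have "q * q * q \<le> p (x, y) * p (x, z) * p (y, z)"
      using q p[of x y] p[of x z] p[of y z] xy by (intro mult_mono mult_nonneg_nonneg) auto
    then show "q ^ 3 \<le> (\<Prod>e\<in>tri_edges t. p e)"
      using xy by (simp add: xyz prod_tri_edges power3_eq_cube)
  qed
  finally show ?thesis .
qed

text \<open>For a fixed triangle there are L^3 choices of a second one, L choices sharing a given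
  edge, and one choice equal to it; the unions have 6, 5 and 3 edges. The three contributions stay
  bounded when L \<open>\<rho>\<close> and \<open>\<rho>\<close> do.\<close>

lemma block_second_moment:
  fixes p :: "int \<times> int \<Rightarrow> real"
  assumes p: "\<And>i j. v \<le> i \<Longrightarrow> i < j \<Longrightarrow> j < v + 3 * int L \<Longrightarrow> 0 \<le> p (i, j) \<and> p (i, j) \<le> \<rho>"
    and \<rho>: "\<rho> \<ge> 0"
  shows "(\<Sum>t\<in>tripartite_block v L. \<Sum>u\<in>tripartite_block v L. \<Prod>e\<in>tri_edges t \<union> tri_edges u. p e)
         \<le> real L ^ 3 * (real L ^ 3 * \<rho> ^ 6 + 3 * (real L * \<rho> ^ 5) + \<rho> ^ 3)"
proof -
  let ?F = "tripartite_block v L"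
  have "(\<Sum>u\<in>?F. \<Prod>e\<in>tri_edges t \<union> tri_edges u. p e) \<le> real L ^ 3 * \<rho> ^ 6 + 3 * (real L * \<rho> ^ 5) + \<rho> ^ 3"
    if t: "t \<in> ?F" for t
  proof -
    obtain x y z where xyz: "t = (x, y, z)" by (cases t)
    \<comment> \<open>These are the triangles of the block through the edge xy, xz and yz of t,
      respectively.\<close>
    define S1 where "S1 = {x} \<times> {y} \<times> {v + 2 * int L..<v + 3 * int L}"
    define S2 where "S2 = {x} \<times> {v + int L..<v + 2 * int L} \<times> {z}"
    define S3 where "S3 = {v..<v + int L} \<times> {y} \<times> {z}"
    have card: "card S1 = L" "card S2 = L" "card S3 = L"
      by (simp_all add: S1_def S2_def S3_def card_cartesian_product)
    have sub: "S1 \<subseteq> ?F" "S2 \<subseteq> ?F" "S3 \<subseteq> ?F"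
      using t by (auto simp: S1_def S2_def S3_def xyz tripartite_block_def)
    \<comment> \<open>The cases may overlap, since t itself lies in all three sets; the extra terms
      are nonnegative, so the upper bound survives.\<close>
    have le: "(\<Prod>e\<in>tri_edges t \<union> tri_edges u. p e)
        \<le> \<rho> ^ 6 + indicator S1 u * \<rho> ^ 5 + indicator S2 u * \<rho> ^ 5 + indicator S3 u * \<rho> ^ 5 + indicator {t} u * \<rho> ^ 3"
      if u: "u \<in> ?F" for u
    proof -
      obtain x' y' z' where xyz': "u = (x', y', z')" by (cases u)
      let ?E = "tri_edges t \<union> tri_edges u"
      \<comment> \<open>These inequalities separate vertices of different thirds, so an edge of t
        can only coincide with the edge of u that joins the same two thirds.\<close>
      have ne: "x < y'" "x < z'" "y < z'" "x' < y" "x' < z" "y' < z" "x < y" "y < z" "x' < y'" "y' < z'"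
        using t u by (auto simp: xyz xyz' tripartite_block_def)
      have "(\<Prod>e\<in>?E. p e) \<le> (\<Prod>e\<in>?E. \<rho>)"
        using p tri_edges_block[OF t] tri_edges_block[OF u] by (intro prod_mono) auto
      also have "\<dots> = \<rho> ^ card ?E" by simp
      \<comment> \<open>Two triangles of a tripartite block share no edge, exactly one edge, or all three.\<close>
      also have "\<dots> \<le> \<rho> ^ 6 + indicator S1 u * \<rho> ^ 5 + indicator S2 u * \<rho> ^ 5 + indicator S3 u * \<rho> ^ 5 + indicator {t} u * \<rho> ^ 3"
      proof -
        have "card ?E = (if x = x' \<and> y = y' \<and> z = z' then 3
            else if x = x' \<and> y = y' \<or> x = x' \<and> z = z' \<or> y = y' \<and> z = z' then 5 else 6)"
          using ne by (auto simp: xyz xyz' tri_edges_def card_insert_if)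
        moreover have "u \<in> S1 \<longleftrightarrow> x = x' \<and> y = y'" "u \<in> S2 \<longleftrightarrow> x = x' \<and> z = z'"
          "u \<in> S3 \<longleftrightarrow> y = y' \<and> z = z'" "u \<in> {t} \<longleftrightarrow> x = x' \<and> y = y' \<and> z = z'"
          using t u by (auto simp: S1_def S2_def S3_def xyz xyz' tripartite_block_def)
        ultimately show ?thesis using \<rho> by (auto simp: indicator_def)
      qed
      finally show ?thesis .
    qed
    have ind: "(\<Sum>u\<in>?F. indicator S u * r) = real (card (?F \<inter> S)) * r" for S and r :: real
      unfolding sum_distrib_right[symmetric] indicator_def by (simp add: sum_of_bool_eq)
    have "(\<Sum>u\<in>?F. \<Prod>e\<in>tri_edges t \<union> tri_edges u. p e)
        \<le> (\<Sum>u\<in>?F. \<rho> ^ 6 + indicator S1 u * \<rho> ^ 5 + indicator S2 u * \<rho> ^ 5 + indicator S3 u * \<rho> ^ 5 + indicator {t} u * \<rho> ^ 3)"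
      by (rule sum_mono[OF le])
    also have "\<dots> = real (card ?F) * \<rho> ^ 6 + real (card (?F \<inter> S1)) * \<rho> ^ 5 + real (card (?F \<inter> S2)) * \<rho> ^ 5
        + real (card (?F \<inter> S3)) * \<rho> ^ 5 + real (card (?F \<inter> {t})) * \<rho> ^ 3"
      by (simp add: sum.distrib ind)
    also have "\<dots> = real L ^ 3 * \<rho> ^ 6 + 3 * (real L * \<rho> ^ 5) + \<rho> ^ 3"
      using sub t card by (simp add: Int_absorb1 Int_absorb2)
    finally show ?thesis .
  qed
  then have "(\<Sum>t\<in>?F. \<Sum>u\<in>?F. \<Prod>e\<in>tri_edges t \<union> tri_edges u. p e)
      \<le> real (card ?F) * (real L ^ 3 * \<rho> ^ 6 + 3 * (real L * \<rho> ^ 5) + \<rho> ^ 3)"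
    by (rule sum_bounded_above)
  then show ?thesis by simp
qed

text \<open>There are m blocks of 3 L consecutive vertices. In a block all edge probabilities lie
  between \<open>\<kappa> * \<rho>\<close> and \<open>\<rho>\<close>, and L \<open>\<rho>\<close> is
  comparable to \<open>\<delta>\<close>, so both moments are controlled independently of n. The
  threshold 6 x compensates the factor 1/6 of \<open>triangles_ge\<close>.\<close>

lemma triangles_lower_tail:
  fixes p :: "int \<times> int \<Rightarrow> real" and L m :: nat
  assumes "indep_bernoulli M (edge_pairs n) X p"
    and Lm: "3 * L * m \<le> graph_size n"
    and upper: "\<And>i j. (i, j) \<in> edge_pairs n \<Longrightarrow> p (i, j) \<le> \<rho>"
    and lower: "\<And>i j. (i, j) \<in> edge_pairs n \<Longrightarrow> j - i < 3 * int L \<Longrightarrow> \<kappa> * \<rho> \<le> p (i, j)"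
    and \<rho>: "0 < \<rho>" "\<rho> \<le> 1" and \<kappa>: "\<kappa> > 0"
    and \<delta>: "\<delta> > 0" "\<delta> / 2 \<le> real L * \<rho>" "real L * \<rho> \<le> \<delta>"
    and m1: "m1 = (\<kappa> * \<delta> / 2) ^ 3" and m2: "m2 = \<delta> ^ 6 + 3 * \<delta> ^ 4 + \<delta> ^ 3"
  shows "measure M {\<omega> \<in> space M. triangles n X \<omega> \<le> x}
         \<le> exp (m1 / (2 * m2) * (6 * x) - real m * (m1\<^sup>2 / (4 * m2)))"
proof -
  interpret indep_bernoulli M "edge_pairs n" X p by fact
  define v where "v = (\<lambda>b. - int n + 3 * int L * int b)"
  define F where "F = (\<lambda>b. tripartite_block (v b) L)"
  have range: "(i, j) \<in> edge_pairs n" if "b < m" "v b \<le> i" "i < j" "j < v b + 3 * int L" for b i j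
  proof -
    have "int (3 * L * Suc b) \<le> int (3 * L * m)"
      using that(1) by (intro of_nat_mono mult_left_mono) auto
    also have "\<dots> \<le> int (graph_size n)" using Lm by (simp only: of_nat_le_iff)
    \<comment> \<open>The last vertex of block b is \<open>v b + 3 * int L - 1\<close>, so n + 1 is
      the right bound.\<close>
    finally have "v b + 3 * int L \<le> int n + 1"
      by (simp add: v_def graph_size_def algebra_simps)
    moreover have "- int n \<le> v b" by (simp add: v_def)
    ultimately show ?thesis using that by (auto simp: edge_pairs_def vertices_def)
  qed
  have v_less: "v b + 3 * int L \<le> v b'" if "b < b'" for b b'
  proof -
    have "int (3 * L * Suc b) \<le> int (3 * L * b')"
      using that by (intro of_nat_mono mult_left_mono) auto
    then show ?thesis by (simp add: v_def algebra_simps)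
  qed
  have sep: "b = b'" if "v b \<le> i" "i < v b + 3 * int L" "v b' \<le> i" "i < v b' + 3 * int L" for b b' i
    using v_less[of b b'] v_less[of b' b] that by (cases b b' rule: linorder_cases) auto
  have E: "tri_edges t \<subseteq> edge_pairs n" if "b < m" "t \<in> F b" for b t
    using tri_edges_block[OF that(2)[unfolded F_def]] range[OF that(1)] by auto
  have disj: "disjoint_family_on (\<lambda>b. \<Union> (tri_edges ` F b)) {..<m}"
  proof (unfold disjoint_family_on_def, safe)
    fix b b' i j t t'
    assume "b \<noteq> b'" and t: "t \<in> F b" "(i, j) \<in> tri_edges t" "t' \<in> F b'" "(i, j) \<in> tri_edges t'"
    \<comment> \<open>The lower endpoint of a shared edge would lie in both blocks, which are
      disjoint intervals.\<close>
    have "b = b'"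
      using tri_edges_block[OF t(1)[unfolded F_def] t(2)] tri_edges_block[OF t(3)[unfolded F_def] t(4)]
      by (intro sep[of b i]) auto
    with \<open>b \<noteq> b'\<close> show "(i, j) \<in> {}" by simp
  qed
  have m1_le: "m1 \<le> (\<Sum>t\<in>F b. \<Prod>e\<in>tri_edges t. p e)" if "b < m" for b
  proof -
    have "\<kappa> * \<delta> / 2 \<le> real L * (\<kappa> * \<rho>)"
      using mult_left_mono[OF \<delta>(2), of \<kappa>] \<kappa> by (simp add: algebra_simps)
    then have "m1 \<le> (real L * (\<kappa> * \<rho>)) ^ 3"
      unfolding m1 using \<kappa> \<delta> by (intro power_mono) auto
    also have "\<dots> \<le> (\<Sum>t\<in>F b. \<Prod>e\<in>tri_edges t. p e)"
      unfolding F_def using \<kappa> \<rho> lower range[OF that] by (intro block_first_moment) auto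
    finally show ?thesis .
  qed
  have m2_ge: "(\<Sum>t\<in>F b. \<Sum>u\<in>F b. \<Prod>e\<in>tri_edges t \<union> tri_edges u. p e) \<le> m2" if "b < m" for b
  proof -
    have "(\<Sum>t\<in>F b. \<Sum>u\<in>F b. \<Prod>e\<in>tri_edges t \<union> tri_edges u. p e)
        \<le> real L ^ 3 * (real L ^ 3 * \<rho> ^ 6 + 3 * (real L * \<rho> ^ 5) + \<rho> ^ 3)"
      unfolding F_def using \<rho> upper p_nonneg range[OF that] by (intro block_second_moment) auto
    \<comment> \<open>The middle term keeps one surplus factor \<open>\<rho>\<close>, which is
      bounded by 1.\<close>
    also have "\<dots> = (real L * \<rho>) ^ 6 + 3 * ((real L * \<rho>) ^ 4 * \<rho>) + (real L * \<rho>) ^ 3"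
      by (simp add: algebra_simps eval_nat_numeral)
    also have "\<dots> \<le> \<delta> ^ 6 + 3 * (\<delta> ^ 4 * 1) + \<delta> ^ 3"
      using \<delta> \<rho> by (intro add_mono mult_left_mono mult_mono power_mono) auto
    finally show ?thesis by (simp add: m2)
  qed
  have pos: "m1 > 0" "m2 > 0"
    using \<kappa> \<delta> by (auto simp: m1 m2 intro!: add_pos_pos)
  have count: "1 / 6 * (\<Sum>b<m. \<Sum>t\<in>F b. \<Prod>e\<in>tri_edges t. X e \<omega>) \<le> triangles n X \<omega>"
    if \<omega>: "\<omega> \<in> space M" for \<omega>
  proof -
    define T where "T = (\<Union>b<m. F b)"
    have T: "x < y \<and> y < z \<and> (x, z) \<in> edge_pairs n" if "(x, y, z) \<in> T" for x y z
    proof -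
      from that obtain b where b: "b < m" "(x, y, z) \<in> F b" by (auto simp: T_def)
      then show ?thesis using E[OF b] by (auto simp: F_def tripartite_block_def tri_edges_def)
    qed
    have "(\<Sum>b<m. \<Sum>t\<in>F b. \<Prod>e\<in>tri_edges t. X e \<omega>) = (\<Sum>t\<in>T. \<Prod>e\<in>tri_edges t. X e \<omega>)"
      unfolding T_def
    proof (rule sum.UNION_disjoint[symmetric])
      show "\<forall>b\<in>{..<m}. \<forall>b'\<in>{..<m}. b \<noteq> b' \<longrightarrow> F b \<inter> F b' = {}"
      proof (safe)
        fix b b' x y z assume "b \<noteq> b'" "(x, y, z) \<in> F b" "(x, y, z) \<in> F b'"
        then show "(x, y, z) \<in> {}"
          using sep[of b x b'] by (auto simp: F_def tripartite_block_def)
      qed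
    qed (auto simp: F_def)
    also have "\<dots> = (\<Sum>(x, y, z)\<in>T. X (x, y) \<omega> * X (x, z) \<omega> * X (y, z) \<omega>)"
      using T by (intro sum.cong) (auto simp: prod_tri_edges)
    finally have "1 / 6 * (\<Sum>b<m. \<Sum>t\<in>F b. \<Prod>e\<in>tri_edges t. X e \<omega>)
        = 1 / 6 * (\<Sum>(x, y, z)\<in>T. X (x, y) \<omega> * X (x, z) \<omega> * X (y, z) \<omega>)" by simp
    also have "\<dots> \<le> triangles n X \<omega>"
    proof (rule triangles_ge)
      show "X e \<omega> \<ge> 0" if "e \<in> edge_pairs n" for e
        using vals[OF that \<omega>] by auto
    qed (use T in \<open>auto simp: edge_pairs_def\<close>)
    finally show ?thesis .
  qed
  have [measurable]: "(\<lambda>\<omega>. \<Sum>b<m. \<Sum>t\<in>F b. \<Prod>e\<in>tri_edges t. X e \<omega>) \<in> borel_measurable M"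
    using rv[OF subsetD[OF E]] by (intro borel_measurable_sum borel_measurable_prod) auto
  have "prob {\<omega> \<in> space M. triangles n X \<omega> \<le> x}
      \<le> prob {\<omega> \<in> space M. (\<Sum>b<m. \<Sum>t\<in>F b. \<Prod>e\<in>tri_edges t. X e \<omega>) \<le> 6 * x}"
    using count by (intro finite_measure_mono) force+
  also have "\<dots> \<le> exp (m1 / (2 * m2) * (6 * x) - real (card {..<m}) * (m1\<^sup>2 / (4 * m2)))"
  proof (rule block_count_lower_tail)
    show "tri_edges t \<subseteq> edge_pairs n" if "b \<in> {..<m}" "t \<in> F b" for b t
      using E that by simp
  qed (use disj m1_le m2_ge pos in \<open>simp_all add: F_def\<close>)
  finally show ?thesis by simp
qed

subsection \<open>Almost sure limits\<close>

theorem theorem6p4: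
  fixes M :: "'w measure"
    and \<psi> :: "real \<Rightarrow> real"
    and V\<^sub>0 \<delta> \<sigma> :: real
    and c R :: "nat \<Rightarrow> real"
    and a :: "nat \<Rightarrow> int \<times> int \<Rightarrow> 'w \<Rightarrow> real"
  assumes psi_even: "\<And>x. \<psi> (- x) = \<psi> x"
    and psi_cont: "continuous_on UNIV \<psi>"
    and psi_pos: "\<And>x. \<psi> x > 0"
    and psi_mono: "mono_on {0..} \<psi>"
    and V0_finite: "integrable lborel (\<lambda>t. exp (- (\<psi> t)\<^sup>2))"
    and V0: "V\<^sub>0 = (\<integral>t. exp (- (\<psi> t)\<^sup>2) \<partial>lborel)"
    and delta: "\<delta> > 0"
    and sigma: "0 < \<sigma>" "\<sigma> < 1"
    and c: "\<And>n. c n = real (graph_size n) powr (1 - \<sigma>)"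
    and R: "\<And>n. R n = \<delta> * real (graph_size n) powr \<sigma>"
    and M: "prob_space M"
    and a: "\<And>n. edge_variables M \<psi> (c n) (R n) n (a n)"
  shows "\<P>(\<omega> in M. (\<lambda>n. avg_degree n (a n) \<omega>) \<longlonglongrightarrow> \<delta> * V\<^sub>0 / 2) = 1
       \<and> \<P>(\<omega> in M. liminf (\<lambda>n. ereal (triangles n (a n) \<omega>)) = \<infinity>) = 1"
proof -
  interpret prob_space M by (rule M)

  \<comment> \<open>Edge probabilities and their scaling\<close>
  define h where "h = (\<lambda>t. exp (- (\<psi> t)\<^sup>2))"
  define N where "N = (\<lambda>n. real (graph_size n))"
  define \<rho> where "\<rho> = (\<lambda>n. N n powr (- \<sigma>))"
  \<comment> \<open>Evenness allows j - i in place of i - j. It is positive on edge pairs, where the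
    monotonicity of \<open>\<psi>\<close> applies.\<close>
  define p where "p = (\<lambda>n (i, j). \<rho> n * h (real_of_int (j - i) / R n))"
  have N: "N n \<ge> 1" for n by (simp add: N_def graph_size_def)
  have \<rho>: "0 < \<rho> n" "\<rho> n \<le> 1" for n
    using N[of n] sigma powr_mono[of "-\<sigma>" 0 "N n"] by (auto simp: \<rho>_def)
  \<comment> \<open>This is c R / N = \<open>\<delta>\<close>. It supplies the mesh 1 / R of the
    Riemann sum, and makes L \<open>\<rho>\<close> comparable to \<open>\<delta>\<close> for blocks
    with L about R.\<close>
  have \<rho>R: "\<rho> n = \<delta> / R n" for n
    using N[of n] delta by (simp add: \<rho>_def R N_def powr_minus divide_inverse)
  have Rpos: "R n > 0" for n
    using N[of n] delta by (simp add: R N_def)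
  have h_even: "h (- t) = h t" for t by (simp add: h_def psi_even)
  have h_pos: "h t > 0" and h_le: "h t \<le> 1" for t by (simp_all add: h_def)
  have h_anti: "h t \<le> h s" if "0 \<le> s" "s \<le> t" for s t
    using mono_onD[OF psi_mono, of s t] that psi_pos[of s] by (auto simp: h_def intro!: power_mono)
  have h_cont: "continuous_on UNIV h"
    unfolding h_def using psi_cont by (intro continuous_intros)
  have bern: "indep_bernoulli M (edge_pairs n) (a n) (p n)" for n
  proof
    show "indep_vars (\<lambda>_. borel) (a n) (edge_pairs n)"
      using a[of n] by (simp add: edge_variables_def)
    fix e assume e: "e \<in> edge_pairs n"
    obtain i j where ij: "e = (i, j)" by (cases e)
    show "a n e \<omega> \<in> {0, 1}" if "\<omega> \<in> space M" for \<omega>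
      using a[of n] e that by (fastforce simp: edge_variables_def ij)
    have "prob {\<omega> \<in> space M. a n e \<omega> = 1} = c n / N n * h (real_of_int (i - j) / R n)"
      using a[of n] e by (fastforce simp: edge_variables_def ij N_def h_def)
    also have "c n / N n = \<rho> n"
      using N[of n] by (simp add: c N_def \<rho>_def powr_diff powr_minus divide_inverse)
    also have "h (real_of_int (i - j) / R n) = h (real_of_int (j - i) / R n)"
      using h_even[of "real_of_int (j - i) / R n"] by (simp add: minus_divide_left)
    finally show "prob {\<omega> \<in> space M. a n e \<omega> = 1} = p n e"
      by (simp add: p_def ij)
  qed simp
  have a_meas [measurable]: "a n e \<in> borel_measurable M" if "e \<in> edge_pairs n" for n e
    using indep_bernoulli.rv[OF bern that] .

  \<comment> \<open>Limit of the mean number of edges per vertex\<close>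
  define \<mu> where "\<mu> = (\<lambda>n. \<Sum>e\<in>edge_pairs n. p n e)"
  have R_lim: "filterlim R at_top sequentially"
    unfolding R graph_size_def using sigma delta by real_asymp
  have RN_lim: "(\<lambda>n. R n / N n) \<longlonglongrightarrow> 0"
    unfolding R N_def graph_size_def using sigma delta by real_asymp
  have "\<mu> n / N n = \<delta> * (\<Sum>d\<in>{1..<graph_size n}. (1 - real d / N n) * h (real d / R n) / R n)" for n
  proof -
    have "\<mu> n = (\<Sum>d\<in>{1..<graph_size n}. (N n - real d) * (\<rho> n * h (real d / R n)))"
      using sum_edge_pairs_diff[of "\<lambda>k. \<rho> n * h (real_of_int k / R n)" n]
      by (simp add: \<mu>_def p_def N_def)
    then show ?thesis
      using N[of n] Rpos[of n]
      by (simp add: sum_divide_distrib sum_distrib_left \<rho>R diff_divide_distrib)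
         (intro sum.cong, auto simp: field_simps)
  qed
  moreover have "(\<lambda>n. \<Sum>d\<in>{1..<graph_size n}. (1 - real d / N n) * h (real d / R n) / R n)
      \<longlonglongrightarrow> (\<integral>t. indicator {0<..} t * h t \<partial>lborel)"
    unfolding N_def
  proof (rule tapered_riemann_sum_tendsto)
    show "(\<lambda>n. R n / real (graph_size n)) \<longlonglongrightarrow> 0" using RN_lim by (simp add: N_def)
  qed (use h_pos h_anti h_cont V0_finite Rpos R_lim in \<open>auto simp: h_def graph_size_def less_imp_le\<close>)
  moreover have "(\<integral>t. indicator {0<..} t * h t \<partial>lborel) = V\<^sub>0 / 2"
    using integral_even_half[of h] h_even V0_finite V0 by (simp add: h_def)
  ultimately have \<mu>_lim: "(\<lambda>n. \<mu> n / N n) \<longlonglongrightarrow> \<delta> * V\<^sub>0 / 2"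
    using tendsto_mult_left[of _ "V\<^sub>0 / 2" sequentially \<delta>] by simp
  then obtain C where C: "C > 0" "\<And>n. norm (\<mu> n / N n) \<le> C"
    using Bseq_def[of "\<lambda>n. \<mu> n / N n"] convergent_imp_Bseq convergentI by metis

  \<comment> \<open>Almost sure convergence of the average degree\<close>
  have avg: "avg_degree n (a n) \<omega> = (\<Sum>e\<in>edge_pairs n. a n e \<omega>) / N n" for n \<omega>
    by (simp add: avg_degree_eq N_def)
  have avg_meas [measurable]: "(\<lambda>\<omega>. avg_degree n (a n) \<omega>) \<in> borel_measurable M" for n
    unfolding avg by measurable
  \<comment> \<open>Deviations 1 / (k + 1) suffice, and being countably many they allow the
    exceptional null sets to be united.\<close>
  have "AE \<omega> in M. \<forall>\<^sub>F n in sequentially. \<not> \<bar>avg_degree n (a n) \<omega> - \<mu> n / N n\<bar> \<ge> 1 / real (Suc k)" for k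
  proof (rule AE_eventually_not)
    define e where "e = 1 / real (Suc k)"
    \<comment> \<open>The Chernoff bound needs t <= 1. Since the mean is at most C N, the choice t C
      <= e / 2 makes the quadratic term absorb at most half of the gain t e N.\<close>
    define t where "t = min 1 (e / (2 * C))"
    have e: "e > 0" by (simp add: e_def)
    have t: "0 < t" "t \<le> 1" "t * C \<le> e / 2"
      using e C by (auto simp: t_def min_def field_simps)
    show "summable (\<lambda>n. 2 * exp (- (t * e / 2) * N n powr 1))"
      unfolding N_def using t e by (intro summable_mult summable_exp_neg_powr) auto
    show "\<forall>\<^sub>F n in sequentially. prob {\<omega> \<in> space M. 1 / real (Suc k) \<le> \<bar>avg_degree n (a n) \<omega> - \<mu> n / N n\<bar>}
        \<le> 2 * exp (- (t * e / 2) * N n powr 1)"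
    proof (rule always_eventually, rule allI)
      fix n
      have "prob {\<omega> \<in> space M. e \<le> \<bar>avg_degree n (a n) \<omega> - \<mu> n / N n\<bar>}
          = prob {\<omega> \<in> space M. e * N n \<le> \<bar>(\<Sum>i\<in>edge_pairs n. a n i \<omega>) - \<mu> n\<bar>}"
        using N[of n] by (simp add: avg diff_divide_distrib[symmetric] pos_le_divide_eq)
      also have "\<dots> \<le> 2 * exp (t\<^sup>2 * \<mu> n - t * (e * N n))"
        unfolding \<mu>_def using t by (intro indep_bernoulli.sum_deviation_le[OF bern])
      also have "t\<^sup>2 * \<mu> n - t * (e * N n) \<le> - (t * e / 2) * N n powr 1"
      proof -
        have "\<mu> n \<le> C * N n" using C(2)[of n] N[of n] by (simp add: field_simps)
        then have "t\<^sup>2 * \<mu> n \<le> t * (t * C) * N n"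
          using t by (simp add: power2_eq_square mult_left_mono mult.assoc)
        also have "\<dots> \<le> t * (e / 2) * N n"
          using t N[of n] by (intro mult_right_mono mult_left_mono) auto
        finally show ?thesis using N[of n] by simp
      qed
      finally show "prob {\<omega> \<in> space M. 1 / real (Suc k) \<le> \<bar>avg_degree n (a n) \<omega> - \<mu> n / N n\<bar>}
        \<le> 2 * exp (- (t * e / 2) * N n powr 1)" by (simp add: e_def)
    qed
  qed measurable
  then have "AE \<omega> in M. \<forall>k. \<forall>\<^sub>F n in sequentially. \<not> \<bar>avg_degree n (a n) \<omega> - \<mu> n / N n\<bar> \<ge> 1 / real (Suc k)"
    by (simp add: AE_all_countable)
  then have "AE \<omega> in M. (\<lambda>n. avg_degree n (a n) \<omega>) \<longlonglongrightarrow> \<delta> * V\<^sub>0 / 2"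
  proof eventually_elim
    case (elim \<omega>)
    have "(\<lambda>n. avg_degree n (a n) \<omega> - \<mu> n / N n) \<longlonglongrightarrow> 0"
    proof (rule tendstoI)
      fix e :: real assume "e > 0"
      then obtain k where k: "1 / real (Suc k) < e" using nat_approx_posE by blast
      show "\<forall>\<^sub>F n in sequentially. dist (avg_degree n (a n) \<omega> - \<mu> n / N n) 0 < e"
        using elim[rule_format, of k] by eventually_elim (use k in \<open>simp add: dist_real_def\<close>)
    qed
    from tendsto_add[OF this \<mu>_lim] show ?case by simp
  qed
  then have first: "\<P>(\<omega> in M. (\<lambda>n. avg_degree n (a n) \<omega>) \<longlonglongrightarrow> \<delta> * V\<^sub>0 / 2) = 1"
    by (subst prob_Collect_eq_1) measurable

  \<comment> \<open>Almost sure divergence of the number of triangles\<close>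
  have adj_meas [measurable]: "(\<lambda>\<omega>. adj_entry (a n) \<omega> i j) \<in> borel_measurable M"
    if "i \<in> vertices n" "j \<in> vertices n" for n i j
    using a_meas[of "(i, j)" n] a_meas[of "(j, i)" n] that
    by (cases i j rule: linorder_cases) (auto simp: adj_entry_def edge_pairs_def)
  have tri_meas [measurable]: "(\<lambda>\<omega>. triangles n (a n) \<omega>) \<in> borel_measurable M" for n
    unfolding triangles_eq by measurable
  \<comment> \<open>Vertices of one block are less than 3 L <= 3 R apart, so h is at least h(3) at
    their scaled distance.\<close>
  define \<kappa> where "\<kappa> = h 3"
  define m1 where "m1 = (\<kappa> * \<delta> / 2) ^ 3"
  define m2 where "m2 = \<delta> ^ 6 + 3 * \<delta> ^ 4 + \<delta> ^ 3"
  define q where "q = m1\<^sup>2 / (4 * m2)"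
  have \<kappa>: "\<kappa> > 0" using h_pos by (simp add: \<kappa>_def)
  have q: "q > 0" using \<kappa> delta by (auto simp: q_def m1_def m2_def intro!: divide_pos_pos add_pos_pos)
  \<comment> \<open>R >= 1 makes the integer part L of R positive and at least R / 2; 3 R <= N
    leaves room for at least one block.\<close>
  have ev: "\<forall>\<^sub>F n in sequentially. R n \<ge> 1 \<and> 3 * R n \<le> N n"
  proof -
    have "\<forall>\<^sub>F n in sequentially. R n / N n < 1 / 3"
      using order_tendstoD(2)[OF RN_lim, of "1 / 3"] by simp
    moreover have "\<forall>\<^sub>F n in sequentially. R n \<ge> 1"
      using R_lim by (simp add: filterlim_at_top)
    ultimately show ?thesis
    proof eventually_elim
      case (elim n)
      then show ?case using N[of n] by (simp add: field_simps)
    qed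
  qed
  have "AE \<omega> in M. \<forall>\<^sub>F n in sequentially. \<not> triangles n (a n) \<omega> \<le> real k" for k :: nat
  proof (rule AE_eventually_not)
    define A where "A = exp (m1 / (2 * m2) * (6 * real k))"
    show "summable (\<lambda>n. A * exp (- (q / (6 * \<delta>)) * N n powr (1 - \<sigma>)))"
      unfolding N_def using q delta sigma by (intro summable_mult summable_exp_neg_powr) auto
    show "\<forall>\<^sub>F n in sequentially. prob {\<omega> \<in> space M. triangles n (a n) \<omega> \<le> real k}
        \<le> A * exp (- (q / (6 * \<delta>)) * N n powr (1 - \<sigma>))"
      using ev
    proof eventually_elim
      case (elim n)
      define L where "L = nat \<lfloor>R n\<rfloor>"
      define m where "m = graph_size n div (3 * L)"
      have L: "L > 0" "real L \<le> R n" "R n / 2 \<le> real L"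
      proof -
        have floor: "1 \<le> \<lfloor>R n\<rfloor>" using elim by simp
        then have "real L = real_of_int \<lfloor>R n\<rfloor>" by (simp add: L_def)
        then show "L > 0" "real L \<le> R n" "R n / 2 \<le> real L"
          using floor by linarith+
      qed
      have Lm: "3 * L * m \<le> graph_size n"
        by (simp add: m_def)
      have "3 * real L \<le> N n" using L elim by linarith
      then have "3 * L \<le> graph_size n" unfolding N_def by linarith
      then have "1 \<le> m" using L by (simp add: m_def div_greater_zero_iff Suc_le_eq)
      \<comment> \<open>Rounding in the number of blocks costs a factor 2, as m + 1 <= 2 m. Hence m
        >= N / (6 R), which is of order N^(1 - \<open>\<sigma>\<close>).\<close>
      have "graph_size n < 3 * L * (m + 1)"
        using L(1) by (simp add: m_def dividend_less_times_div)
      then have "N n \<le> real (3 * L * (m + 1))"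
        unfolding N_def by linarith
      also have "\<dots> \<le> real (3 * L * (2 * m))"
        using \<open>1 \<le> m\<close> by (intro of_nat_mono mult_left_mono) auto
      also have "\<dots> = 6 * real m * real L" by simp
      also have "\<dots> \<le> 6 * real m * R n"
        using L by (intro mult_left_mono) auto
      finally have "N n / (6 * R n) \<le> real m"
        using Rpos[of n] by (simp add: field_simps)
      moreover have "N n / (6 * R n) = N n powr (1 - \<sigma>) / (6 * \<delta>)"
        using N[of n] delta by (simp add: R N_def powr_diff field_simps)
      ultimately have m: "q / (6 * \<delta>) * N n powr (1 - \<sigma>) \<le> real m * q"
        using q mult_left_mono[of "N n powr (1 - \<sigma>) / (6 * \<delta>)" "real m" q] by (simp add: field_simps)
      have "prob {\<omega> \<in> space M. triangles n (a n) \<omega> \<le> real k}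
          \<le> exp (m1 / (2 * m2) * (6 * real k) - real m * (m1\<^sup>2 / (4 * m2)))"
      proof (rule triangles_lower_tail[OF bern Lm _ _ \<rho> \<kappa> delta _ _ m1_def m2_def])
        fix i j assume ij: "(i, j) \<in> edge_pairs n"
        show "p n (i, j) \<le> \<rho> n"
          using h_le \<rho>(1)[of n] by (simp add: p_def)
        assume "j - i < 3 * int L"
        then have "real_of_int (j - i) \<le> 3 * real L" by linarith
        also have "\<dots> \<le> 3 * R n" using L by simp
        finally have "h 3 \<le> h (real_of_int (j - i) / R n)"
          using ij Rpos[of n] by (intro h_anti) (auto simp: edge_pairs_def field_simps)
        then show "\<kappa> * \<rho> n \<le> p n (i, j)"
          using \<rho>(1)[of n] by (simp add: p_def \<kappa>_def mult.commute)
      qed (use L Rpos[of n] delta in \<open>simp_all add: \<rho>R field_simps\<close>)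
      also have "\<dots> = A * exp (- (real m * q))"
        unfolding A_def q_def mult_exp_exp by simp
      also have "\<dots> \<le> A * exp (- (q / (6 * \<delta>)) * N n powr (1 - \<sigma>))"
        using m by (intro mult_left_mono) (auto simp: A_def)
      finally show ?case .
    qed
  qed measurable
  then have "AE \<omega> in M. \<forall>k. \<forall>\<^sub>F n in sequentially. \<not> triangles n (a n) \<omega> \<le> real k"
    by (simp add: AE_all_countable)
  then have "AE \<omega> in M. liminf (\<lambda>n. ereal (triangles n (a n) \<omega>)) = \<infinity>"
  proof eventually_elim
    case (elim \<omega>)
    show ?case
    proof (rule ereal_top)
      fix B :: real
      obtain k :: nat where k: "B \<le> real k" using real_arch_simple by blast
      show "ereal B \<le> liminf (\<lambda>n. ereal (triangles n (a n) \<omega>))"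
      proof (rule Liminf_bounded)
        show "\<forall>\<^sub>F n in sequentially. ereal B \<le> ereal (triangles n (a n) \<omega>)"
          using elim[rule_format, of k] by eventually_elim (use k in simp)
      qed
    qed
  qed
  then have second: "\<P>(\<omega> in M. liminf (\<lambda>n. ereal (triangles n (a n) \<omega>)) = \<infinity>) = 1"
    by (subst prob_Collect_eq_1) measurable
  from first second show ?thesis by blast
qed

end
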